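(* Let $(X,d,\delta)$ be a metric space with dilations, with group of scales $\Gamma=(0,\infty)$, and let $e\in X$. There is a neighbourhood $U_0$ of $e$ with the following property. Let $K\subset U_0$ be a compact neighbourhood of $e$, let $p>0$ be such that $\Delta^e_\varepsilon(a,b)$ is defined for all $a,b\in K$ and all $\varepsilon\in(0,p)$, and let $\mu>0$. Then there is a constant $C(\mu)>0$ with $C(\mu)<p$ (depending on $\mu$, and possibly on $e,K,p$, but not on the sets below) such that for all finite sets $A,B,C\subset K$ for which, for every $\varepsilon\in(0,p)$, the sets $B$ and $\Delta^e_\varepsilon(C,A)$ are $\mu$ separated, and for every $\varepsilon\in(0,C(\mu)]$, there is an injective function $$ i^e_\varepsilon : \Delta^e_\varepsilon(C,A)\times B\to\Delta^e_\varepsilon(B,C)\times\Delta^e_\varepsilon(B,A). $$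
   Context: A metric space with dilations (also called a dilatation structure) $(X,d,\delta)$, with group of scales $\Gamma=(0,\infty)$ under multiplication, is a complete, locally compact metric space $(X,d)$ together with, for each $x\in X$ and $\varepsilon>0$, a locally defined map $\delta^x_\varepsilon : \mathrm{dom}\,\delta^x_\varepsilon\subset X\to X$ (the dilation of base point $x$ and coefficient $\varepsilon$), such that: (A0) There are numbers $1<\alpha<\beta$ and, for each $x\in X$, an open neighbourhood $U(x)$ of $x$ containing the closed ball $\bar B(x,\alpha)$, such that for $\varepsilon\in(0,1]$ the map $\delta^x_\varepsilon: U(x)\to V_\varepsilon(x)$ is a homeomorphism onto an open neighbourhood $V_\varepsilon(x)$ of $x$. For $\varepsilon\in(0,1)$ the map $\delta^x_{\varepsilon^{-1}}$ is defined on an open set $W_{\varepsilon^{-1}}(x)$ with values in the ball $B(x,\beta)$, and $B(x,\varepsilon)\subset\delta^x_\varepsilon B(x,\alpha)\subset V_\varepsilon(x)\subset W_{\varepsilon^{-1}}(x)$. For every compact $K\subset X$ there are $R=R(K)>0$ and $\varepsilon_0=\varepsilon_0(K)\in(0,1)$ such that for all $x\in K$, $u,v\in\bar B(x,R)$ and $\varepsilon\in(0,\varepsilon_0)$ one has $\delta^x_\varepsilon v\in W_{\varepsilon^{-1}}(\delta^x_\varepsilon u)$. (A1) $\delta^x_\varepsilon x=x$ and $\delta^x_1=\mathrm{id}$; the map $(\varepsilon,x,y)\mapsto\delta^x_\varepsilon y$ is continuous on its domain; and $\delta^x_\varepsilon y\to x$ as $\varepsilon\to0$, uniformly for $(x,y)$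 in compact sets. (A2) $\delta^x_\varepsilon\delta^x_\mu y=\delta^x_{\varepsilon\mu}y$ whenever both sides make sense. (A3) For each $x$ there is a distance $d^x$ on $\bar B(x,\alpha)$ (so $d^x(u,v)=0$ implies $u=v$) such that $\sup\{|\varepsilon^{-1}d(\delta^x_\varepsilon u,\delta^x_\varepsilon v)-d^x(u,v)| : u,v\in\bar B(x,\alpha)\}\to0$ as $\varepsilon\to0$, uniformly for $x$ in compact sets. (A4) With $\Delta^x_\varepsilon(u,v)=\delta^{\delta^x_\varepsilon u}_{\varepsilon^{-1}}\,\delta^x_\varepsilon v$, the limit $\lim_{\varepsilon\to0}\Delta^x_\varepsilon(u,v)=\Delta^x(u,v)$ exists, uniformly for $x,u,v$ in compact sets (with $u,v$ close enough to $x$ for the expressions to be defined). The approximate difference function based at $e\in X$ is, for close points $a,b$, $$\Delta^e_\varepsilon(a,b)=\delta^{\delta^e_\varepsilon a}_{\varepsilon^{-1}}\,\delta^e_\varepsilon b .$$ For sets $A,B$ of points close to $e$, $\Delta^e_\varepsilon(A,B)=\{\Delta^e_\varepsilon(a,b): a\in A,\ b\in B\}$. For $\mu>0$, a set $S\subset X$ is $\mu$ separated if for all $x,y\in S$, $d(x,y)<\mu$ implies $x=y$. *)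

theory Defs
  imports "HOL-Analysis.Analysis"
begin

text \<open>
  We write \<open>\<delta> x \<epsilon> y\<close> for the dilation of base point \<open>x\<close> and coefficient \<open>\<epsilon>\<close> applied to \<open>y\<close>.
  Dilations are only locally defined: \<open>\<delta> x \<epsilon>\<close> has domain \<open>U x\<close> if \<open>0 < \<epsilon> \<le> 1\<close> and domain
  \<open>W x \<epsilon>\<close> if \<open>\<epsilon> > 1\<close>. The values of the total HOL function outside these domains are never
  constrained.
\<close>

definition dilation_dom ::
  "('a \<Rightarrow> 'a set) \<Rightarrow> ('a \<Rightarrow> real \<Rightarrow> 'a set) \<Rightarrow> 'a \<Rightarrow> real \<Rightarrow> 'a set" where
  "dilation_dom U W x \<epsilon> = (if \<epsilon> \<le> 1 then U x else W x \<epsilon>)"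

definition approx_diff ::
  "('a \<Rightarrow> real \<Rightarrow> 'a \<Rightarrow> 'a) \<Rightarrow> real \<Rightarrow> 'a \<Rightarrow> 'a \<Rightarrow> 'a \<Rightarrow> 'a" where
  "approx_diff \<delta> \<epsilon> x u v = \<delta> (\<delta> x \<epsilon> u) (1 / \<epsilon>) (\<delta> x \<epsilon> v)"

definition approx_diff_defined ::
  "('a \<Rightarrow> real \<Rightarrow> 'a \<Rightarrow> 'a) \<Rightarrow> ('a \<Rightarrow> 'a set) \<Rightarrow> ('a \<Rightarrow> real \<Rightarrow> 'a set)
    \<Rightarrow> real \<Rightarrow> 'a \<Rightarrow> 'a \<Rightarrow> 'a \<Rightarrow> bool" where
  "approx_diff_defined \<delta> U W \<epsilon> x u v \<longleftrightarrow>
     u \<in> dilation_dom U W x \<epsilon> \<and> v \<in> dilation_dom U W x \<epsilon> \<and>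
     \<delta> x \<epsilon> v \<in> dilation_dom U W (\<delta> x \<epsilon> u) (1 / \<epsilon>)"

definition approx_diff_set ::
  "('a \<Rightarrow> real \<Rightarrow> 'a \<Rightarrow> 'a) \<Rightarrow> real \<Rightarrow> 'a \<Rightarrow> 'a set \<Rightarrow> 'a set \<Rightarrow> 'a set" where
  "approx_diff_set \<delta> \<epsilon> x A B = {approx_diff \<delta> \<epsilon> x a b |a b. a \<in> A \<and> b \<in> B}"

definition separated :: "real \<Rightarrow> 'a::metric_space set \<Rightarrow> bool" where
  "separated \<mu> S \<longleftrightarrow> (\<forall>x\<in>S. \<forall>y\<in>S. dist x y < \<mu> \<longrightarrow> x = y)"

text \<open>
  The open set \<open>V\<^sub>\<epsilon>(x)\<close> is the image \<open>\<delta> x \<epsilon> ` U x\<close>. In \<open>A1_limit\<close> and \<open>A4\<close>, convergence is uniform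
  on the compact sets of pairs, respectively triples, on which the functions in question are defined
  (for all sufficiently small \<open>\<epsilon>\<close>). In \<open>A3\<close>, uniform convergence on the set of all \<open>(x, u, v)\<close>
  with \<open>x \<in> K\<close> and \<open>u, v\<close> in the closed ball of centre \<open>x\<close> expresses that the
  supremum over \<open>u, v\<close> tends to 0, uniformly for \<open>x \<in> K\<close>.
\<close>

locale dilation_structure =
  fixes \<delta> :: "'a::complete_space \<Rightarrow> real \<Rightarrow> 'a \<Rightarrow> 'a"
    and U :: "'a \<Rightarrow> 'a set"
    and W :: "'a \<Rightarrow> real \<Rightarrow> 'a set"
    and \<alpha> \<beta> :: real
  assumes locally_compact: "locally compact (UNIV :: 'a set)"
    and A0_const: "1 < \<alpha>" "\<alpha> < \<beta>"
    and A0_U: "open (U x)" "cball x \<alpha> \<subseteq> U x"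
    and A0_homeo: "0 < \<epsilon> \<Longrightarrow> \<epsilon> \<le> 1 \<Longrightarrow>
          open (\<delta> x \<epsilon> ` U x) \<and> x \<in> \<delta> x \<epsilon> ` U x \<and>
          (\<exists>g. homeomorphism (U x) (\<delta> x \<epsilon> ` U x) (\<delta> x \<epsilon>) g)"
    and A0_W: "0 < \<epsilon> \<Longrightarrow> \<epsilon> < 1 \<Longrightarrow>
          open (W x (1 / \<epsilon>)) \<and> \<delta> x (1 / \<epsilon>) ` W x (1 / \<epsilon>) \<subseteq> ball x \<beta>"
    and A0_incl: "0 < \<epsilon> \<Longrightarrow> \<epsilon> < 1 \<Longrightarrow>
          ball x \<epsilon> \<subseteq> \<delta> x \<epsilon> ` ball x \<alpha> \<and>
          \<delta> x \<epsilon> ` ball x \<alpha> \<subseteq> \<delta> x \<epsilon> ` U x \<and>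
          \<delta> x \<epsilon> ` U x \<subseteq> W x (1 / \<epsilon>)"
    and A0_compact: "compact K \<Longrightarrow>
          \<exists>R>0. \<exists>\<epsilon>\<^sub>0. 0 < \<epsilon>\<^sub>0 \<and> \<epsilon>\<^sub>0 < 1 \<and>
            (\<forall>x\<in>K. cball x R \<subseteq> U x \<and>
              (\<forall>u\<in>cball x R. \<forall>v\<in>cball x R. \<forall>\<epsilon>\<in>{0<..<\<epsilon>\<^sub>0}.
                 \<delta> x \<epsilon> v \<in> W (\<delta> x \<epsilon> u) (1 / \<epsilon>)))"
    and A1_base: "0 < \<epsilon> \<Longrightarrow> \<delta> x \<epsilon> x = x"
    and A1_one: "y \<in> U x \<Longrightarrow> \<delta> x 1 y = y"
    and A1_continuous:
          "continuous_on {(\<epsilon>, x, y). 0 < \<epsilon> \<and> y \<in> dilation_dom U W x \<epsilon>} (\<lambda>(\<epsilon>, x, y). \<delta> x \<epsilon> y)"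
    and A1_limit: "compact P \<Longrightarrow> P \<subseteq> {(x, y). y \<in> U x} \<Longrightarrow>
          uniform_limit P (\<lambda>\<epsilon> (x, y). \<delta> x \<epsilon> y) (\<lambda>(x, y). x) (at_right 0)"
    and A2: "0 < \<epsilon> \<Longrightarrow> 0 < \<mu> \<Longrightarrow> y \<in> dilation_dom U W x \<mu> \<Longrightarrow>
          \<delta> x \<mu> y \<in> dilation_dom U W x \<epsilon> \<Longrightarrow> y \<in> dilation_dom U W x (\<epsilon> * \<mu>) \<Longrightarrow>
          \<delta> x \<epsilon> (\<delta> x \<mu> y) = \<delta> x (\<epsilon> * \<mu>) y"
    and A3: "\<exists>d. (\<forall>x. Metric_space (cball x \<alpha>) (d x)) \<and>
          (\<forall>K. compact K \<longrightarrow>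
            uniform_limit {(x, u, v). x \<in> K \<and> u \<in> cball x \<alpha> \<and> v \<in> cball x \<alpha>}
              (\<lambda>\<epsilon> (x, u, v). dist (\<delta> x \<epsilon> u) (\<delta> x \<epsilon> v) / \<epsilon>) (\<lambda>(x, u, v). d x u v) (at_right 0))"
    and A4: "\<exists>\<Delta>. \<forall>T. compact T \<and>
            (\<exists>\<epsilon>\<^sub>0>0. \<forall>(x, u, v)\<in>T. \<forall>\<epsilon>\<in>{0<..<\<epsilon>\<^sub>0}. approx_diff_defined \<delta> U W \<epsilon> x u v) \<longrightarrow>
          uniform_limit T (\<lambda>\<epsilon> (x, u, v). approx_diff \<delta> \<epsilon> x u v) (\<lambda>(x, u, v). \<Delta> x u v) (at_right 0)"

end

theory Submission
  imports Defs
begin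

text \<open>
  The map is \<open>(\<Delta>(c, a), b) \<mapsto> (\<Delta>(b, c), \<Delta>(b, a))\<close> for a fixed choice of \<open>(c, a)\<close> representing
  each point of \<open>\<Delta>(C, A)\<close>, as in Ruzsa's triangle inequality. With \<open>y = \<delta>\<^sup>e\<^sub>\<epsilon> b\<close> one has exactly
  \<open>\<Delta>\<^sup>y(\<Delta>\<^sup>e(b, c), \<Delta>\<^sup>e(b, a)) = \<Delta>\<^sup>e(c, a)\<close>. Since \<open>y\<close> tends to \<open>e\<close> uniformly and the approximate
  differences are equicontinuous as \<open>\<epsilon> \<rightarrow> 0\<close>, the image determines \<open>\<Delta>\<^sup>e(c, a)\<close> up to an error
  smaller than \<open>\<mu>\<close>, hence exactly, by separation. Then \<open>c\<close> is known, and the same identity with \<open>b\<close> in the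
  place of \<open>a\<close> reads \<open>\<Delta>\<^sup>y(\<Delta>\<^sup>e(b, c), y) = \<Delta>\<^sup>e(c, b)\<close>, which determines \<open>\<Delta>\<^sup>e(c, b)\<close> up to a
  small error. Comparing rescaled distances through (A3) then determines \<open>b\<close> up to an error smaller
  than \<open>\<mu>\<close>, hence exactly.
\<close>

section \<open>Uniform limits on compact sets and the metric on triples\<close>

text \<open>The limit \<open>g\<close> is uniformly continuous on the compact set \<open>T\<close>,
  and its modulus passes to \<open>f \<epsilon>\<close> by a three-term estimate. Since
  \<open>\<kappa>\<close> comes from \<open>g\<close>, it does not depend on
  \<open>\<epsilon>\<close>; continuity of each single \<open>f \<epsilon>\<close> would not give
  that.\<close>

lemma uniform_limit_asymptotically_equicontinuous:
  fixes f :: "'b \<Rightarrow> 'c::metric_space \<Rightarrow> 'd::metric_space"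
  assumes lim: "uniform_limit T f g F" and cont: "\<forall>\<^sub>F \<epsilon> in F. continuous_on T (f \<epsilon>)"
    and nontriv: "F \<noteq> bot" and T: "compact T" and "0 < \<eta>"
  obtains \<kappa> where "0 < \<kappa>"
    "\<forall>\<^sub>F \<epsilon> in F. \<forall>s\<in>T. \<forall>t\<in>T. dist s t < \<kappa> \<longrightarrow> dist (f \<epsilon> s) (f \<epsilon> t) < \<eta>"
proof -
  have "uniformly_continuous_on T g"
    using uniform_limit_theorem[OF cont lim] nontriv T compact_uniformly_continuous
    by (simp add: trivial_limit_def)
  then obtain \<kappa> where \<kappa>: "0 < \<kappa>" "\<And>s t. s \<in> T \<Longrightarrow> t \<in> T \<Longrightarrow> dist s t < \<kappa> \<Longrightarrow> dist (g s) (g t) < \<eta>/3"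
    unfolding uniformly_continuous_on_def using \<open>0 < \<eta>\<close>
    by (metis dist_commute zero_less_divide_iff zero_less_numeral)
  have "\<forall>\<^sub>F \<epsilon> in F. \<forall>s\<in>T. dist (f \<epsilon> s) (g s) < \<eta>/3"
    using uniform_limitD[OF lim, of "\<eta>/3"] \<open>0 < \<eta>\<close> by simp
  then have "\<forall>\<^sub>F \<epsilon> in F. \<forall>s\<in>T. \<forall>t\<in>T. dist s t < \<kappa> \<longrightarrow> dist (f \<epsilon> s) (f \<epsilon> t) < \<eta>"
  proof eventually_elim
    case (elim \<epsilon>)
    show ?case
    proof (intro ballI impI)
      fix s t assume st: "s \<in> T" "t \<in> T" "dist s t < \<kappa>"
      have "dist (f \<epsilon> s) (f \<epsilon> t) \<le> dist (f \<epsilon> s) (g s) + dist (g s) (g t) + dist (f \<epsilon> t) (g t)"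
        by metric
      also have "\<dots> < \<eta>"
        using elim[rule_format, OF st(1)] elim[rule_format, OF st(2)] \<kappa>(2)[OF st] by linarith
      finally show "dist (f \<epsilon> s) (f \<epsilon> t) < \<eta>" .
    qed
  qed
  with \<kappa>(1) show ?thesis by (rule that)
qed

lemma dist_triple_le:
  "dist (x, u, v) (x', u', v') \<le> dist x x' + dist u u' + dist v v'"
proof -
  have "dist (u, v) (u', v') \<le> dist u u' + dist v v'"
    by (simp add: dist_Pair_Pair sqrt_sum_squares_le_sum)
  moreover have "dist (x, u, v) (x', u', v') \<le> dist x x' + dist (u, v) (u', v')"
    by (simp only: dist_Pair_Pair sqrt_sum_squares_le_sum zero_le_dist real_sqrt_ge_zero add_nonneg_nonneg zero_le_power2)
  ultimately show ?thesis by linarith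
qed

section \<open>Direct consequences of the axioms\<close>

context dilation_structure
begin

lemma continuous_on_dilation:
  assumes "0 < \<epsilon>" "continuous_on S f" "continuous_on S g"
    and "\<And>s. s \<in> S \<Longrightarrow> g s \<in> dilation_dom U W (f s) \<epsilon>"
  shows "continuous_on S (\<lambda>s. \<delta> (f s) \<epsilon> (g s))"
proof -
  have "continuous_on S (\<lambda>s. (\<epsilon>, f s, g s))"
    using assms by (intro continuous_intros)
  from continuous_on_compose2[OF A1_continuous this] show ?thesis
    using assms by auto
qed

lemma continuous_on_approx_diff:
  assumes "0 < \<epsilon>" and "\<And>x u v. (x, u, v) \<in> T \<Longrightarrow> approx_diff_defined \<delta> U W \<epsilon> x u v"
  shows "continuous_on T (\<lambda>(x, u, v). approx_diff \<delta> \<epsilon> x u v)"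
proof -
  have "approx_diff_defined \<delta> U W \<epsilon> (fst t) (fst (snd t)) (snd (snd t))" if "t \<in> T" for t
    using assms(2) that by (metis prod.collapse)
  then show ?thesis
    using assms(1) unfolding approx_diff_def case_prod_unfold approx_diff_defined_def
    by (intro continuous_on_dilation continuous_intros) auto
qed

text \<open>Axiom \<open>A2\<close> composes the coefficients \<open>\<epsilon>\<close> and
  \<open>1/\<epsilon>\<close> at the base point \<open>\<delta> x \<epsilon> u\<close> to the
  coefficient 1. The assumptions \<open>dom\<close> place the intermediate point in the domain of
  the outer dilation and the starting point in that of the identity dilation.\<close>

lemma approx_diff_inverse:
  assumes "0 < \<epsilon>" and def: "approx_diff_defined \<delta> U W \<epsilon> x u v"
    and dom: "approx_diff \<delta> \<epsilon> x u v \<in> dilation_dom U W (\<delta> x \<epsilon> u) \<epsilon>" "\<delta> x \<epsilon> v \<in> U (\<delta> x \<epsilon> u)"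
  shows "\<delta> (\<delta> x \<epsilon> u) \<epsilon> (approx_diff \<delta> \<epsilon> x u v) = \<delta> x \<epsilon> v"
proof -
  have "\<delta> (\<delta> x \<epsilon> u) \<epsilon> (\<delta> (\<delta> x \<epsilon> u) (1/\<epsilon>) (\<delta> x \<epsilon> v)) = \<delta> (\<delta> x \<epsilon> u) (\<epsilon> * (1/\<epsilon>)) (\<delta> x \<epsilon> v)"
    using assms by (intro A2) (auto simp: approx_diff_def approx_diff_defined_def dilation_dom_def)
  then show ?thesis
    using assms by (simp add: approx_diff_def A1_one)
qed

text \<open>A dilation fixes its base point. This lets the moving base point
  \<open>\<delta> e \<epsilon> b\<close> be read as the difference of \<open>b\<close> with
  itself.\<close>

lemma approx_diff_self: "0 < \<epsilon> \<Longrightarrow> approx_diff \<delta> \<epsilon> x u u = \<delta> x \<epsilon> u"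
  by (simp add: approx_diff_def A1_base)

lemma compact_cball_exists: "\<exists>r>0. compact (cball (e :: 'a) r)"
proof -
  obtain N V where "e \<in> N" "N \<subseteq> V" "open N" "compact V"
    using locallyE[OF locally_compact, of UNIV e] by (metis UNIV_I open_UNIV open_openin subtopology_UNIV)
  then obtain r where "r > 0" "cball e r \<subseteq> V"
    by (meson open_contains_cball subset_trans)
  then have "compact (cball e r)"
    using \<open>compact V\<close> by (metis closed_cball compact_Int_closed inf.absorb_iff2)
  with \<open>r > 0\<close> show ?thesis by blast
qed

end

section \<open>A compact ball around e on which all expressions are defined\<close>

text \<open>The condition \<open>2 * \<rho> \<le> \<alpha>\<close> puts the whole ball inside
  \<open>cball x \<alpha>\<close> for every centre \<open>x\<close> of the ball, not only for
  \<open>e\<close>. This matters because the base points move with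
  \<open>\<epsilon>\<close>.\<close>

locale dilation_chart = dilation_structure \<delta> U W \<alpha> \<beta>
  for \<delta> :: "'a::complete_space \<Rightarrow> real \<Rightarrow> 'a \<Rightarrow> 'a" and U W \<alpha> \<beta> +
  fixes e :: 'a and \<rho> :: real
  assumes radius: "0 < \<rho>" "2 * \<rho> \<le> \<alpha>"
    and compact_chart: "compact (cball e \<rho>)"
    and approx_diff_defined_chart: "\<forall>\<^sub>F \<epsilon> in at_right 0.
      \<forall>x\<in>cball e \<rho>. \<forall>u\<in>cball e \<rho>. \<forall>v\<in>cball e \<rho>. approx_diff_defined \<delta> U W \<epsilon> x u v"

lemma (in dilation_structure) dilation_chart_exists: "\<exists>\<rho>. dilation_chart \<delta> U W \<alpha> \<beta> e \<rho>"
proof -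
  obtain r where r: "0 < r" "compact (cball e r)"
    using compact_cball_exists by blast
  obtain R \<epsilon>\<^sub>0 where R: "0 < R" "0 < \<epsilon>\<^sub>0" "\<epsilon>\<^sub>0 < 1" and R_dom: "\<And>x. x \<in> cball e r \<Longrightarrow> cball x R \<subseteq> U x"
    and R_def: "\<And>x u v \<epsilon>. x \<in> cball e r \<Longrightarrow> u \<in> cball x R \<Longrightarrow> v \<in> cball x R \<Longrightarrow> \<epsilon> \<in> {0<..<\<epsilon>\<^sub>0} \<Longrightarrow>
      \<delta> x \<epsilon> v \<in> W (\<delta> x \<epsilon> u) (1 / \<epsilon>)"
    using A0_compact[OF r(2)] by metis
  \<comment> \<open>The bound \<open>r\<close> keeps base points in the compact set to which
    \<open>A0_compact\<close> was applied; \<open>R/2\<close> and \<open>\<alpha>/2\<close> make any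
    two points of the chart at most \<open>R\<close> and \<open>\<alpha>\<close> apart.\<close>
  define \<rho> where "\<rho> = min (min r (R/2)) (\<alpha>/2)"
  have \<rho>: "0 < \<rho>" "\<rho> \<le> r" "2 * \<rho> \<le> R" "2 * \<rho> \<le> \<alpha>"
    using r R A0_const by (auto simp: \<rho>_def)
  have "approx_diff_defined \<delta> U W \<epsilon> x u v"
    if "x \<in> cball e \<rho>" "u \<in> cball e \<rho>" "v \<in> cball e \<rho>" "\<epsilon> \<in> {0<..<\<epsilon>\<^sub>0}" for x u v \<epsilon>
  proof -
    have "dist x u \<le> R" "dist x v \<le> R" "x \<in> cball e r"
      using that(1-3) \<rho> dist_triangle3[of x u e] dist_triangle3[of x v e] by auto
    then show ?thesis
      using that R R_dom[of x] R_def[of x u v \<epsilon>]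
      by (auto simp: approx_diff_defined_def dilation_dom_def)
  qed
  then have "\<forall>\<^sub>F \<epsilon> in at_right 0. \<forall>x\<in>cball e \<rho>. \<forall>u\<in>cball e \<rho>. \<forall>v\<in>cball e \<rho>.
      approx_diff_defined \<delta> U W \<epsilon> x u v"
    using R(2) unfolding eventually_at_right_field by (intro exI[of _ \<epsilon>\<^sub>0]) auto
  moreover have "compact (cball e \<rho>)"
    using r(2) \<rho>(2) by (metis closed_cball compact_Int_closed inf.absorb_iff2 subset_cball)
  ultimately have "dilation_chart \<delta> U W \<alpha> \<beta> e \<rho>"
    using \<rho> by unfold_locales auto
  then show ?thesis ..
qed

section \<open>Estimates on the chart, uniform for small scales\<close>

context dilation_chart
begin

abbreviation N where "N \<equiv> cball e \<rho>"

lemma compact_triples: "compact (N \<times> N \<times> N)"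
  by (intro compact_Times compact_chart)

lemma chart_subset_cball: "x \<in> N \<Longrightarrow> N \<subseteq> cball x \<alpha>"
proof
  fix y assume "x \<in> N" "y \<in> N"
  then show "y \<in> cball x \<alpha>"
    using radius dist_triangle3[of x y e] by simp
qed

lemma chart_subset_U: "x \<in> N \<Longrightarrow> N \<subseteq> U x"
  using chart_subset_cball A0_U by blast

lemma center_in_chart: "e \<in> N"
  using radius by simp

lemma eventually_small: "\<forall>\<^sub>F \<epsilon> in at_right (0::real). 0 < \<epsilon> \<and> \<epsilon> < 1"
  unfolding eventually_at_right_field by (intro exI[of _ 1]) auto

lemma dilation_near_center:
  assumes "0 < \<eta>"
  shows "\<forall>\<^sub>F \<epsilon> in at_right 0. \<forall>b\<in>N. dist (\<delta> e \<epsilon> b) e < \<eta>"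
proof -
  have "uniform_limit ({e} \<times> N) (\<lambda>\<epsilon> (x, y). \<delta> x \<epsilon> y) (\<lambda>(x, y). x) (at_right 0)"
    using chart_subset_U[OF center_in_chart]
    by (intro A1_limit compact_Times compact_chart) auto
  from uniform_limitD[OF this assms] show ?thesis
    by simp
qed

text \<open>By \<open>A4\<close> the differences converge uniformly on the compact set of triples,
  so the general lemma applies. The base point varies along with the arguments, so that differences
  at \<open>\<delta> e \<epsilon> b\<close> and \<open>\<delta> e \<epsilon> b'\<close> can be
  compared.\<close>

lemma approx_diff_equicontinuous:
  assumes "0 < \<eta>"
  obtains \<kappa> where "0 < \<kappa>" "\<forall>\<^sub>F \<epsilon> in at_right 0. \<forall>x\<in>N. \<forall>u\<in>N. \<forall>v\<in>N. \<forall>x'\<in>N. \<forall>u'\<in>N. \<forall>v'\<in>N.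
    dist x x' + dist u u' + dist v v' < \<kappa> \<longrightarrow>
    dist (approx_diff \<delta> \<epsilon> x u v) (approx_diff \<delta> \<epsilon> x' u' v') < \<eta>"
proof -
  let ?f = "\<lambda>\<epsilon> (x, u, v). approx_diff \<delta> \<epsilon> x u v"
  obtain \<epsilon>\<^sub>0 where \<epsilon>\<^sub>0: "0 < \<epsilon>\<^sub>0" "\<And>\<epsilon> x u v. \<epsilon> \<in> {0<..<\<epsilon>\<^sub>0} \<Longrightarrow> x \<in> N \<Longrightarrow> u \<in> N \<Longrightarrow> v \<in> N \<Longrightarrow>
      approx_diff_defined \<delta> U W \<epsilon> x u v"
    using approx_diff_defined_chart unfolding eventually_at_right_field
    by (metis greaterThanLessThan_iff)
  obtain \<Delta> where "uniform_limit (N \<times> N \<times> N) ?f (\<lambda>(x, u, v). \<Delta> x u v) (at_right 0)"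
    using A4 compact_triples \<epsilon>\<^sub>0 by fast
  moreover have "\<forall>\<^sub>F \<epsilon> in at_right 0. continuous_on (N \<times> N \<times> N) (?f \<epsilon>)"
    using approx_diff_defined_chart eventually_small
    by eventually_elim (intro continuous_on_approx_diff, auto)
  ultimately obtain \<kappa> where \<kappa>: "0 < \<kappa>" "\<forall>\<^sub>F \<epsilon> in at_right 0. \<forall>s\<in>N \<times> N \<times> N. \<forall>t\<in>N \<times> N \<times> N.
      dist s t < \<kappa> \<longrightarrow> dist (?f \<epsilon> s) (?f \<epsilon> t) < \<eta>"
    by (rule uniform_limit_asymptotically_equicontinuous[OF _ _ trivial_limit_at_right_real compact_triples assms])
  from \<kappa>(2) have "\<forall>\<^sub>F \<epsilon> in at_right 0. \<forall>x\<in>N. \<forall>u\<in>N. \<forall>v\<in>N. \<forall>x'\<in>N. \<forall>u'\<in>N. \<forall>v'\<in>N.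
    dist x x' + dist u u' + dist v v' < \<kappa> \<longrightarrow>
    dist (approx_diff \<delta> \<epsilon> x u v) (approx_diff \<delta> \<epsilon> x' u' v') < \<eta>"
  proof eventually_elim
    case (elim \<epsilon>)
    show ?case
    proof (intro ballI impI)
      fix x u v x' u' v'
      assume in_N: "x \<in> N" "u \<in> N" "v \<in> N" "x' \<in> N" "u' \<in> N" "v' \<in> N"
        and "dist x x' + dist u u' + dist v v' < \<kappa>"
      then have "dist (x, u, v) (x', u', v') < \<kappa>"
        using dist_triple_le order_le_less_trans by blast
      then show "dist (approx_diff \<delta> \<epsilon> x u v) (approx_diff \<delta> \<epsilon> x' u' v') < \<eta>"
        using elim[rule_format, of "(x, u, v)" "(x', u', v')"] in_N by simp
    qed
  qed
  with \<kappa>(1) show ?thesis by (rule that)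
qed

lemma continuous_on_rescaled_dist:
  assumes "0 < \<epsilon>" "\<epsilon> < 1"
  shows "continuous_on (N \<times> N \<times> N) (\<lambda>(x, u, v). dist (\<delta> x \<epsilon> u) (\<delta> x \<epsilon> v) / \<epsilon>)"
  using assms unfolding case_prod_unfold
  by (intro continuous_intros continuous_on_dilation)
    (auto simp: dilation_dom_def simp del: mem_cball intro: chart_subset_U[THEN subsetD])

text \<open>Joint continuity of the limit distance in base point and arguments is not part of
  \<open>A3\<close>; it is inherited from the rescaled distances through uniform
  convergence.\<close>

lemma rescaled_dist_limit:
  obtains d where "\<And>x. Metric_space (cball x \<alpha>) (d x)"
    "uniform_limit (N \<times> N \<times> N)
      (\<lambda>\<epsilon> (x, u, v). dist (\<delta> x \<epsilon> u) (\<delta> x \<epsilon> v) / \<epsilon>) (\<lambda>(x, u, v). d x u v) (at_right 0)"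
    "continuous_on (N \<times> N \<times> N) (\<lambda>(x, u, v). d x u v)"
proof -
  let ?f = "\<lambda>\<epsilon> (x, u, v). dist (\<delta> x \<epsilon> u) (\<delta> x \<epsilon> v) / \<epsilon>"
  obtain d where d: "\<And>x. Metric_space (cball x \<alpha>) (d x)" "uniform_limit
      {(x, u, v). x \<in> N \<and> u \<in> cball x \<alpha> \<and> v \<in> cball x \<alpha>} ?f (\<lambda>(x, u, v). d x u v) (at_right 0)"
    using A3 compact_chart by blast
  have lim: "uniform_limit (N \<times> N \<times> N) ?f (\<lambda>(x, u, v). d x u v) (at_right 0)"
    using chart_subset_cball by (intro uniform_limit_on_subset[OF d(2)]) blast
  have "\<forall>\<^sub>F \<epsilon> in at_right 0. continuous_on (N \<times> N \<times> N) (?f \<epsilon>)"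
    using eventually_small by eventually_elim (use continuous_on_rescaled_dist in auto)
  then have "continuous_on (N \<times> N \<times> N) (\<lambda>(x, u, v). d x u v)"
    using lim by (rule uniform_limit_theorem) simp
  with d(1) lim show ?thesis by (rule that)
qed

text \<open>Rescaled distances vanish on the diagonal, so equicontinuity is applied to
  \<open>(x, u, v)\<close> and \<open>(x, u, u)\<close>. The bound holds at all base points of
  \<open>N\<close> since it is later used at \<open>\<delta> e \<epsilon> c\<close>.\<close>

lemma rescaled_dist_upper:
  assumes "0 < \<eta>"
  obtains \<kappa> where "0 < \<kappa>" "\<forall>\<^sub>F \<epsilon> in at_right 0. \<forall>x\<in>N. \<forall>u\<in>N. \<forall>v\<in>N. dist u v < \<kappa> \<longrightarrow>
    dist (\<delta> x \<epsilon> u) (\<delta> x \<epsilon> v) / \<epsilon> < \<eta>"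
proof -
  let ?f = "\<lambda>\<epsilon> (x, u, v). dist (\<delta> x \<epsilon> u) (\<delta> x \<epsilon> v) / \<epsilon>"
  obtain d where "uniform_limit (N \<times> N \<times> N) ?f (\<lambda>(x, u, v). d x u v) (at_right 0)"
    by (rule rescaled_dist_limit)
  moreover have "\<forall>\<^sub>F \<epsilon> in at_right 0. continuous_on (N \<times> N \<times> N) (?f \<epsilon>)"
    using eventually_small by eventually_elim (use continuous_on_rescaled_dist in auto)
  ultimately obtain \<kappa> where \<kappa>: "0 < \<kappa>" "\<forall>\<^sub>F \<epsilon> in at_right 0. \<forall>s\<in>N \<times> N \<times> N. \<forall>t\<in>N \<times> N \<times> N.
      dist s t < \<kappa> \<longrightarrow> dist (?f \<epsilon> s) (?f \<epsilon> t) < \<eta>"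
    by (rule uniform_limit_asymptotically_equicontinuous[OF _ _ trivial_limit_at_right_real compact_triples assms])
  from \<kappa>(2) eventually_small have "\<forall>\<^sub>F \<epsilon> in at_right 0. \<forall>x\<in>N. \<forall>u\<in>N. \<forall>v\<in>N. dist u v < \<kappa> \<longrightarrow>
    dist (\<delta> x \<epsilon> u) (\<delta> x \<epsilon> v) / \<epsilon> < \<eta>"
  proof eventually_elim
    case (elim \<epsilon>)
    show ?case
    proof (intro ballI impI)
      fix x u v
      assume in_N: "x \<in> N" "u \<in> N" "v \<in> N" and "dist u v < \<kappa>"
      then have "dist (x, u, v) (x, u, u) < \<kappa>"
        using dist_triple_le[of x u v x u u] by (simp add: dist_commute)
      then show "dist (\<delta> x \<epsilon> u) (\<delta> x \<epsilon> v) / \<epsilon> < \<eta>"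
        using elim(1)[rule_format, of "(x, u, v)" "(x, u, u)"] elim(2) in_N
        by (auto simp: dist_real_def)
    qed
  qed
  with \<kappa>(1) show ?thesis by (rule that)
qed

text \<open>Nondegeneracy of the limit distance enters here: it is positive off the diagonal, hence
  bounded below by some \<open>m > 0\<close> on the compact set of pairs at least
  \<open>\<mu>\<close> apart. Uniform convergence within \<open>m/2\<close> keeps the rescaled
  distances of these pairs above \<open>m/2\<close>.\<close>

lemma rescaled_dist_lower:
  assumes "0 < \<mu>"
  obtains \<eta> where "0 < \<eta>" "\<forall>\<^sub>F \<epsilon> in at_right 0. \<forall>u\<in>N. \<forall>v\<in>N.
    dist (\<delta> e \<epsilon> u) (\<delta> e \<epsilon> v) / \<epsilon> < \<eta> \<longrightarrow> dist u v < \<mu>"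
proof -
  let ?f = "\<lambda>\<epsilon> (x, u, v). dist (\<delta> x \<epsilon> u) (\<delta> x \<epsilon> v) / \<epsilon>"
  obtain d where metric: "\<And>x. Metric_space (cball x \<alpha>) (d x)"
    and lim: "uniform_limit (N \<times> N \<times> N) ?f (\<lambda>(x, u, v). d x u v) (at_right 0)"
    and cont: "continuous_on (N \<times> N \<times> N) (\<lambda>(x, u, v). d x u v)"
    by (rule rescaled_dist_limit) blast
  define S where "S = (N \<times> N) \<inter> {p. \<mu> \<le> dist (fst p) (snd p)}"
  have "closed {p :: 'a \<times> 'a. \<mu> \<le> dist (fst p) (snd p)}"
    by (intro closed_Collect_le continuous_intros)
  then have "compact S"
    unfolding S_def by (intro compact_Int_closed compact_Times compact_chart)
  have contS: "continuous_on S (\<lambda>p. d e (fst p) (snd p))"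
    using continuous_on_compose2[OF cont, of S "\<lambda>p. (e, fst p, snd p)"] center_in_chart
    by (force simp: S_def intro!: continuous_intros)
  have pos: "0 < d e (fst p) (snd p)" if "p \<in> S" for p
  proof -
    interpret Metric_space "cball e \<alpha>" "d e" by (rule metric)
    have "fst p \<in> cball e \<alpha>" "snd p \<in> cball e \<alpha>" "fst p \<noteq> snd p"
      using that assms chart_subset_cball[OF center_in_chart] by (auto simp: S_def)
    then show ?thesis using mdist_pos_less by blast
  qed
  obtain m where m: "0 < m" "\<And>p. p \<in> S \<Longrightarrow> m \<le> d e (fst p) (snd p)"
  \<comment> \<open>If no two points of \<open>N\<close> are \<open>\<mu>\<close> apart there is no
    minimum to take, and any positive number serves as \<open>m\<close>.\<close>
  proof (cases "S = {}")
    case True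
    with that[of 1] show ?thesis by simp
  next
    case False
    with continuous_attains_inf[OF \<open>compact S\<close> _ contS] pos that show ?thesis by metis
  qed
  have "\<forall>\<^sub>F \<epsilon> in at_right 0. \<forall>t\<in>N \<times> N \<times> N. dist (?f \<epsilon> t) ((\<lambda>(x, u, v). d x u v) t) < m/2"
    using uniform_limitD[OF lim, of "m/2"] m(1) by simp
  then have "\<forall>\<^sub>F \<epsilon> in at_right 0. \<forall>u\<in>N. \<forall>v\<in>N.
      dist (\<delta> e \<epsilon> u) (\<delta> e \<epsilon> v) / \<epsilon> < m/2 \<longrightarrow> dist u v < \<mu>"
  proof eventually_elim
    case (elim \<epsilon>)
    show ?case
    proof (intro ballI impI, rule ccontr)
      fix u v
      assume uv: "u \<in> N" "v \<in> N" "dist (\<delta> e \<epsilon> u) (\<delta> e \<epsilon> v) / \<epsilon> < m/2" "\<not> dist u v < \<mu>"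
      have "(u, v) \<in> S" using uv by (simp add: S_def)
      then have "m \<le> d e u v" using m(2) by fastforce
      moreover have "\<bar>dist (\<delta> e \<epsilon> u) (\<delta> e \<epsilon> v) / \<epsilon> - d e u v\<bar> < m/2"
        using elim[rule_format, of "(e, u, v)"] uv center_in_chart by (simp add: dist_real_def)
      ultimately show False using uv(3) by linarith
    qed
  qed
  with m(1) show ?thesis by (intro that[of "m/2"]) auto
qed

text \<open>The difference of \<open>e\<close> with itself is exactly \<open>e\<close>, so
  equicontinuity with tolerance \<open>\<rho>\<close> keeps nearby differences in the chart. They
  can then serve as arguments of further differences.\<close>

lemma approx_diff_near_center:
  obtains r where "0 < r" "r \<le> \<rho>"
    "\<forall>\<^sub>F \<epsilon> in at_right 0. \<forall>u\<in>cball e r. \<forall>v\<in>cball e r. approx_diff \<delta> \<epsilon> e u v \<in> N"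
proof -
  obtain \<kappa> where \<kappa>: "0 < \<kappa>" "\<forall>\<^sub>F \<epsilon> in at_right 0. \<forall>x\<in>N. \<forall>u\<in>N. \<forall>v\<in>N. \<forall>x'\<in>N. \<forall>u'\<in>N. \<forall>v'\<in>N.
    dist x x' + dist u u' + dist v v' < \<kappa> \<longrightarrow>
    dist (approx_diff \<delta> \<epsilon> x u v) (approx_diff \<delta> \<epsilon> x' u' v') < \<rho>"
    by (rule approx_diff_equicontinuous[OF radius(1)])
  define r where "r = min \<rho> (\<kappa>/3)"
  have r: "0 < r" "r \<le> \<rho>" "2 * r < \<kappa>"
    using \<kappa>(1) radius by (auto simp: r_def)
  have "\<forall>\<^sub>F \<epsilon> in at_right 0. \<forall>u\<in>cball e r. \<forall>v\<in>cball e r. approx_diff \<delta> \<epsilon> e u v \<in> N"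
    using \<kappa>(2) eventually_small
  proof eventually_elim
    case (elim \<epsilon>)
    show ?case
    proof (intro ballI)
      fix u v assume uv: "u \<in> cball e r" "v \<in> cball e r"
      have "dist (approx_diff \<delta> \<epsilon> e e e) (approx_diff \<delta> \<epsilon> e u v) < \<rho>"
        using elim(1)[rule_format, of e e e e u v] uv r center_in_chart by auto
      then show "approx_diff \<delta> \<epsilon> e u v \<in> N"
        using elim(2) by (simp add: approx_diff_self A1_base)
    qed
  qed
  with r(1,2) show ?thesis by (rule that)
qed

section \<open>The exact identity and recovery from a pair of differences\<close>

text \<open>Dilating by \<open>\<epsilon>\<close> at \<open>\<delta> e \<epsilon> b\<close> undoes
  the outer dilation in both inner differences and leaves \<open>\<delta> e \<epsilon> c\<close> and
  \<open>\<delta> e \<epsilon> a\<close>. The identity is exact at a fixed scale, not only in the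
  limit.\<close>

lemma approx_diff_approx_diff:
  assumes "0 < \<epsilon>" "\<epsilon> < 1"
    and "approx_diff_defined \<delta> U W \<epsilon> e b c" "approx_diff_defined \<delta> U W \<epsilon> e b a"
    and "\<delta> e \<epsilon> b \<in> N" "\<delta> e \<epsilon> c \<in> N" "\<delta> e \<epsilon> a \<in> N"
    and "approx_diff \<delta> \<epsilon> e b c \<in> N" "approx_diff \<delta> \<epsilon> e b a \<in> N"
  shows "approx_diff \<delta> \<epsilon> (\<delta> e \<epsilon> b) (approx_diff \<delta> \<epsilon> e b c) (approx_diff \<delta> \<epsilon> e b a)
    = approx_diff \<delta> \<epsilon> e c a"
proof -
  have "\<delta> (\<delta> e \<epsilon> b) \<epsilon> (approx_diff \<delta> \<epsilon> e b w) = \<delta> e \<epsilon> w" if "w \<in> {a, c}" for w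
    using assms that chart_subset_U[OF assms(5)]
    by (intro approx_diff_inverse) (auto simp: dilation_dom_def)
  \<comment> \<open>The instantiations unfold only the outer difference and the right-hand side; the
    inner differences stay folded so that the inversion equations can rewrite them.\<close>
  then show ?thesis by (simp add: approx_diff_def[of _ _ "\<delta> e \<epsilon> b"] approx_diff_def[of _ _ e c])
qed

text \<open>The radius \<open>r\<close> precedes \<open>\<mu>\<close>, as the neighbourhood in the
  theorem must. The bound on \<open>b\<close> is conditional on \<open>c = c'\<close>, because
  \<open>c\<close> becomes known only after separation has identified the difference of
  \<open>c\<close> and \<open>a\<close>.\<close>

lemma approx_diff_pair_determines:
  obtains r where "0 < r" "\<And>\<mu>. 0 < \<mu> \<Longrightarrow> \<forall>\<^sub>F \<epsilon> in at_right 0.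
    \<forall>a\<in>cball e r. \<forall>b\<in>cball e r. \<forall>c\<in>cball e r. \<forall>a'\<in>cball e r. \<forall>b'\<in>cball e r. \<forall>c'\<in>cball e r.
      approx_diff \<delta> \<epsilon> e b c = approx_diff \<delta> \<epsilon> e b' c' \<longrightarrow>
      approx_diff \<delta> \<epsilon> e b a = approx_diff \<delta> \<epsilon> e b' a' \<longrightarrow>
      dist (approx_diff \<delta> \<epsilon> e c a) (approx_diff \<delta> \<epsilon> e c' a') < \<mu> \<and> (c = c' \<longrightarrow> dist b b' < \<mu>)"
proof -
  obtain r where r: "0 < r" "r \<le> \<rho>"
    and diff_N: "\<forall>\<^sub>F \<epsilon> in at_right 0. \<forall>u\<in>cball e r. \<forall>v\<in>cball e r. approx_diff \<delta> \<epsilon> e u v \<in> N"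
    by (rule approx_diff_near_center)
  show ?thesis
  proof (rule that[OF r(1)])
    fix \<mu> :: real assume "0 < \<mu>"
    \<comment> \<open>The constants are chosen backwards: \<open>\<eta>\<close> forces
      \<open>b\<close> and \<open>b'\<close> within \<open>\<mu>\<close>, \<open>\<kappa>\<close>
      forces a rescaled distance below \<open>\<eta>\<close>, and \<open>\<theta>\<close> forces
      differences within both \<open>\<mu>\<close> and \<open>\<kappa>\<close>.\<close>
    obtain \<eta> where "0 < \<eta>" and lower: "\<forall>\<^sub>F \<epsilon> in at_right 0. \<forall>u\<in>N. \<forall>v\<in>N.
        dist (\<delta> e \<epsilon> u) (\<delta> e \<epsilon> v) / \<epsilon> < \<eta> \<longrightarrow> dist u v < \<mu>"
      by (rule rescaled_dist_lower[OF \<open>0 < \<mu>\<close>])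
    obtain \<kappa> where "0 < \<kappa>" and upper: "\<forall>\<^sub>F \<epsilon> in at_right 0. \<forall>x\<in>N. \<forall>u\<in>N. \<forall>v\<in>N. dist u v < \<kappa> \<longrightarrow>
        dist (\<delta> x \<epsilon> u) (\<delta> x \<epsilon> v) / \<epsilon> < \<eta>"
      by (rule rescaled_dist_upper[OF \<open>0 < \<eta>\<close>])
    have "0 < min \<mu> \<kappa>" using \<open>0 < \<mu>\<close> \<open>0 < \<kappa>\<close> by simp
    then obtain \<theta> where "0 < \<theta>" and equi: "\<forall>\<^sub>F \<epsilon> in at_right 0.
        \<forall>x\<in>N. \<forall>u\<in>N. \<forall>v\<in>N. \<forall>x'\<in>N. \<forall>u'\<in>N. \<forall>v'\<in>N. dist x x' + dist u u' + dist v v' < \<theta> \<longrightarrow>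
        dist (approx_diff \<delta> \<epsilon> x u v) (approx_diff \<delta> \<epsilon> x' u' v') < min \<mu> \<kappa>"
      by (rule approx_diff_equicontinuous)
    \<comment> \<open>The bound \<open>\<rho>\<close> keeps the points
      \<open>\<delta> e \<epsilon> w\<close> in the chart. With \<open>\<theta>/4\<close>, two of
      them are less than \<open>\<theta>/2\<close> apart, which leaves room for this displacement to
      be counted twice.\<close>
    have "0 < min \<rho> (\<theta>/4)" using \<open>0 < \<theta>\<close> radius by simp
    note near = dilation_near_center[OF this]
    show "\<forall>\<^sub>F \<epsilon> in at_right 0.
      \<forall>a\<in>cball e r. \<forall>b\<in>cball e r. \<forall>c\<in>cball e r. \<forall>a'\<in>cball e r. \<forall>b'\<in>cball e r. \<forall>c'\<in>cball e r.
        approx_diff \<delta> \<epsilon> e b c = approx_diff \<delta> \<epsilon> e b' c' \<longrightarrow>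
        approx_diff \<delta> \<epsilon> e b a = approx_diff \<delta> \<epsilon> e b' a' \<longrightarrow>
        dist (approx_diff \<delta> \<epsilon> e c a) (approx_diff \<delta> \<epsilon> e c' a') < \<mu> \<and> (c = c' \<longrightarrow> dist b b' < \<mu>)"
      using lower upper equi near diff_N approx_diff_defined_chart eventually_small
    proof eventually_elim
      case (elim \<epsilon>)
      have sub: "cball e r \<subseteq> N" using r by auto
      have \<epsilon>: "0 < \<epsilon>" "\<epsilon> < 1" using elim by auto
      have base: "\<delta> e \<epsilon> w \<in> N" if "w \<in> cball e r" for w
        using elim(4)[rule_format, of w] subsetD[OF sub that] by (simp add: dist_commute)
      have def: "approx_diff_defined \<delta> U W \<epsilon> e u v" if "u \<in> cball e r" "v \<in> cball e r" for u v
        using elim(6) that sub center_in_chart by blast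
      have chain: "approx_diff \<delta> \<epsilon> (\<delta> e \<epsilon> b) (approx_diff \<delta> \<epsilon> e b c) (approx_diff \<delta> \<epsilon> e b a)
          = approx_diff \<delta> \<epsilon> e c a" if "a \<in> cball e r" "b \<in> cball e r" "c \<in> cball e r" for a b c
        using that elim(5) by (intro approx_diff_approx_diff \<epsilon> def base) auto
      show ?case
      proof (intro ballI impI)
        fix a b c a' b' c'
        assume a: "a \<in> cball e r" and b: "b \<in> cball e r" and c: "c \<in> cball e r"
          and a': "a' \<in> cball e r" and b': "b' \<in> cball e r" and c': "c' \<in> cball e r"
          and eqc: "approx_diff \<delta> \<epsilon> e b c = approx_diff \<delta> \<epsilon> e b' c'"
          and eqa: "approx_diff \<delta> \<epsilon> e b a = approx_diff \<delta> \<epsilon> e b' a'"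
        have "dist (\<delta> e \<epsilon> b) (\<delta> e \<epsilon> b') \<le> dist (\<delta> e \<epsilon> b) e + dist (\<delta> e \<epsilon> b') e"
          by metric
        also have "\<dots> < \<theta>/2"
          using elim(4)[rule_format, of b] elim(4)[rule_format, of b'] b b' sub by fastforce
        finally have yy': "dist (\<delta> e \<epsilon> b) (\<delta> e \<epsilon> b') < \<theta>/2" .
        note diff_N = elim(5)[rule_format]
        \<comment> \<open>The inner differences agree by hypothesis, so only the base points
          differ.\<close>
        have "dist (approx_diff \<delta> \<epsilon> e c a) (approx_diff \<delta> \<epsilon> e c' a') < \<mu>"
          unfolding chain[OF a b c, symmetric] chain[OF a' b' c', symmetric] eqc eqa
          using elim(3)[rule_format, OF base[OF b] diff_N[OF b' c'] diff_N[OF b' a']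
              base[OF b'] diff_N[OF b' c'] diff_N[OF b' a']] yy' \<open>0 < \<theta>\<close>
          by simp
        moreover have "dist b b' < \<mu>" if "c = c'"
        proof -
          \<comment> \<open>The identity with \<open>b\<close> in place of \<open>a\<close> has
            \<open>\<delta> e \<epsilon> b\<close> both as base point and as last argument, so the
            total displacement is twice that of the base points, still below
            \<open>\<theta>\<close>.\<close>
          have "dist (approx_diff \<delta> \<epsilon> e c b) (approx_diff \<delta> \<epsilon> e c b') < \<kappa>"
            using elim(3)[rule_format, OF base[OF b] diff_N[OF b c] base[OF b]
                base[OF b'] diff_N[OF b' c'] base[OF b']] yy' \<epsilon> that eqc
              chain[OF b b c] chain[OF b' b' c']
            by (simp add: approx_diff_self)
          then have "dist (\<delta> (\<delta> e \<epsilon> c) \<epsilon> (approx_diff \<delta> \<epsilon> e c b)) (\<delta> (\<delta> e \<epsilon> c) \<epsilon> (approx_diff \<delta> \<epsilon> e c b')) / \<epsilon> < \<eta>"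
            using elim(2) base[OF c] diff_N[OF c b] diff_N[OF c b'] by blast
          \<comment> \<open>Dilating back at \<open>\<delta> e \<epsilon> c\<close> turns the
            previous bound into one on the rescaled distance of
            \<open>\<delta> e \<epsilon> b\<close> and \<open>\<delta> e \<epsilon> b'\<close>, to
            which \<open>lower\<close> applies.\<close>
          moreover have "\<delta> (\<delta> e \<epsilon> c) \<epsilon> (approx_diff \<delta> \<epsilon> e c w) = \<delta> e \<epsilon> w" if "w \<in> cball e r" for w
            using \<epsilon> that base[OF that] diff_N[OF c that] chart_subset_U[OF base[OF c]]
            by (intro approx_diff_inverse def c) (auto simp: dilation_dom_def)
          ultimately show ?thesis
            using elim(1)[rule_format, OF subsetD[OF sub b] subsetD[OF sub b']] b b' by simp
        qed
        ultimately show "dist (approx_diff \<delta> \<epsilon> e c a) (approx_diff \<delta> \<epsilon> e c' a') < \<mu> \<and>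
            (c = c' \<longrightarrow> dist b b' < \<mu>)" by blast
      qed
    qed
  qed
qed

end

section \<open>The combinatorial injection\<close>

text \<open>Fixing one representative pair per difference makes \<open>c\<close> a function of
  \<open>x\<close>. Recovering \<open>x\<close> from the image therefore recovers \<open>c\<close>,
  and this unlocks the conditional conclusion \<open>b = b'\<close>.\<close>

lemma ruzsa_injection_exists:
  fixes D :: "'a \<Rightarrow> 'a \<Rightarrow> 'b"
  assumes "\<And>a b c a' b' c'. \<lbrakk>a \<in> A; b \<in> B; c \<in> C; a' \<in> A; b' \<in> B; c' \<in> C;
      D b c = D b' c'; D b a = D b' a'\<rbrakk> \<Longrightarrow> D c a = D c' a' \<and> (c = c' \<longrightarrow> b = b')"
  shows "\<exists>i. i \<in> {D c a |c a. c \<in> C \<and> a \<in> A} \<times> B \<rightarrow>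
      {D b c |b c. b \<in> B \<and> c \<in> C} \<times> {D b a |b a. b \<in> B \<and> a \<in> A} \<and>
    inj_on i ({D c a |c a. c \<in> C \<and> a \<in> A} \<times> B)"
proof -
  let ?X = "{D c a |c a. c \<in> C \<and> a \<in> A}"
  have "\<forall>x\<in>?X. \<exists>s. fst s \<in> C \<and> snd s \<in> A \<and> x = D (fst s) (snd s)" by force
  from bchoice[OF this] obtain s where
    s: "\<forall>x\<in>?X. fst (s x) \<in> C \<and> snd (s x) \<in> A \<and> x = D (fst (s x)) (snd (s x))" ..
  define c a where "c = fst \<circ> s" and "a = snd \<circ> s"
  have ca: "c x \<in> C \<and> a x \<in> A \<and> x = D (c x) (a x)" if "x \<in> ?X" for x
    using s that by (simp add: c_def a_def)
  let ?i = "\<lambda>(x, b). (D b (c x), D b (a x))"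
  have "?i \<in> ?X \<times> B \<rightarrow> {D b c |b c. b \<in> B \<and> c \<in> C} \<times> {D b a |b a. b \<in> B \<and> a \<in> A}"
    using ca by fast
  moreover have "inj_on ?i (?X \<times> B)"
  proof (rule inj_onI)
    fix s t assume "s \<in> ?X \<times> B" "t \<in> ?X \<times> B" and eq: "?i s = ?i t"
    then obtain x b x' b' where st: "s = (x, b)" "t = (x', b')" "x \<in> ?X" "b \<in> B" "x' \<in> ?X" "b' \<in> B"
      by blast
    have "D (c x) (a x) = D (c x') (a x') \<and> (c x = c x' \<longrightarrow> b = b')"
      using eq ca[OF st(3)] ca[OF st(5)] st by (intro assms) auto
    moreover have "c x = c x' \<and> a x = a x'" if "x = x'"
      using that by simp
    moreover have "x = D (c x) (a x)" "x' = D (c x') (a x')"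
      using ca[OF st(3)] ca[OF st(5)] by blast+
    ultimately have "x = x'" "b = b'" by simp_all
    with st show "s = t" by simp
  qed
  ultimately show ?thesis by blast
qed

section \<open>From approximate to exact recovery by separation\<close>

theorem proposition3:
  fixes \<delta> :: "'a::complete_space \<Rightarrow> real \<Rightarrow> 'a \<Rightarrow> 'a"
    and U :: "'a \<Rightarrow> 'a set"
    and W :: "'a \<Rightarrow> real \<Rightarrow> 'a set"
    and \<alpha> \<beta> :: real
    and e :: 'a
  assumes "dilation_structure \<delta> U W \<alpha> \<beta>"
  shows "\<exists>U\<^sub>0. e \<in> interior U\<^sub>0 \<and>
    (\<forall>K p \<mu>.
      compact K \<and> e \<in> interior K \<and> K \<subseteq> U\<^sub>0 \<and>
      0 < p \<and> (\<forall>a\<in>K. \<forall>b\<in>K. \<forall>\<epsilon>\<in>{0<..<p}. approx_diff_defined \<delta> U W \<epsilon> e a b) \<and>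
      0 < \<mu> \<longrightarrow>
      (\<exists>C\<^sub>\<mu>. 0 < C\<^sub>\<mu> \<and> C\<^sub>\<mu> < p \<and>
        (\<forall>A B C.
          finite A \<and> finite B \<and> finite C \<and> A \<subseteq> K \<and> B \<subseteq> K \<and> C \<subseteq> K \<and>
          (\<forall>\<epsilon>\<in>{0<..<p}. separated \<mu> B \<and> separated \<mu> (approx_diff_set \<delta> \<epsilon> e C A)) \<longrightarrow>
          (\<forall>\<epsilon>\<in>{0<..C\<^sub>\<mu>}. \<exists>i.
            i \<in> approx_diff_set \<delta> \<epsilon> e C A \<times> B \<rightarrow>
                  approx_diff_set \<delta> \<epsilon> e B C \<times> approx_diff_set \<delta> \<epsilon> e B A \<and>
            inj_on i (approx_diff_set \<delta> \<epsilon> e C A \<times> B)))))"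
proof -
  interpret dilation_structure \<delta> U W \<alpha> \<beta> by (rule assms)
  obtain \<rho> where "dilation_chart \<delta> U W \<alpha> \<beta> e \<rho>"
    using dilation_chart_exists by blast
  then interpret dilation_chart \<delta> U W \<alpha> \<beta> e \<rho> .
  obtain r where "0 < r" and determines: "\<And>\<mu>. 0 < \<mu> \<Longrightarrow> \<forall>\<^sub>F \<epsilon> in at_right 0.
    \<forall>a\<in>cball e r. \<forall>b\<in>cball e r. \<forall>c\<in>cball e r. \<forall>a'\<in>cball e r. \<forall>b'\<in>cball e r. \<forall>c'\<in>cball e r.
      approx_diff \<delta> \<epsilon> e b c = approx_diff \<delta> \<epsilon> e b' c' \<longrightarrow>
      approx_diff \<delta> \<epsilon> e b a = approx_diff \<delta> \<epsilon> e b' a' \<longrightarrow>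
      dist (approx_diff \<delta> \<epsilon> e c a) (approx_diff \<delta> \<epsilon> e c' a') < \<mu> \<and> (c = c' \<longrightarrow> dist b b' < \<mu>)"
    by (rule approx_diff_pair_determines) blast
  show ?thesis
  proof (rule exI[of _ "cball e r"], intro conjI allI impI)
    show "e \<in> interior (cball e r)"
      using \<open>0 < r\<close> centre_in_ball[of e r] interior_maximal[OF ball_subset_cball open_ball] by blast
  next
    fix K :: "'a set" and p \<mu> :: real
    assume asm: "compact K \<and> e \<in> interior K \<and> K \<subseteq> cball e r \<and>
      0 < p \<and> (\<forall>a\<in>K. \<forall>b\<in>K. \<forall>\<epsilon>\<in>{0<..<p}. approx_diff_defined \<delta> U W \<epsilon> e a b) \<and> 0 < \<mu>"
    then have K: "K \<subseteq> cball e r" and "0 < p" "0 < \<mu>" by auto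
    obtain q where "0 < q" and q: "\<And>\<epsilon>. 0 < \<epsilon> \<Longrightarrow> \<epsilon> < q \<Longrightarrow>
        \<forall>a\<in>cball e r. \<forall>b\<in>cball e r. \<forall>c\<in>cball e r. \<forall>a'\<in>cball e r. \<forall>b'\<in>cball e r. \<forall>c'\<in>cball e r.
          approx_diff \<delta> \<epsilon> e b c = approx_diff \<delta> \<epsilon> e b' c' \<longrightarrow>
          approx_diff \<delta> \<epsilon> e b a = approx_diff \<delta> \<epsilon> e b' a' \<longrightarrow>
          dist (approx_diff \<delta> \<epsilon> e c a) (approx_diff \<delta> \<epsilon> e c' a') < \<mu> \<and> (c = c' \<longrightarrow> dist b b' < \<mu>)"
      using determines[OF \<open>0 < \<mu>\<close>] unfolding eventually_at_right_field by blast
    \<comment> \<open>Halving makes the constant strictly smaller than \<open>p\<close> and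
      \<open>q\<close>, as the admissible scales include the endpoint \<open>C\<^sub>\<mu>\<close>
      while both thresholds are strict.\<close>
    define C\<^sub>\<mu> where "C\<^sub>\<mu> = min p q / 2"
    have C\<^sub>\<mu>: "0 < C\<^sub>\<mu>" "C\<^sub>\<mu> < p" "C\<^sub>\<mu> < q"
      using \<open>0 < p\<close> \<open>0 < q\<close> by (auto simp: C\<^sub>\<mu>_def)
    have "\<exists>i. i \<in> approx_diff_set \<delta> \<epsilon> e C A \<times> B \<rightarrow>
          approx_diff_set \<delta> \<epsilon> e B C \<times> approx_diff_set \<delta> \<epsilon> e B A \<and>
        inj_on i (approx_diff_set \<delta> \<epsilon> e C A \<times> B)"
      if sub: "A \<subseteq> K" "B \<subseteq> K" "C \<subseteq> K" and \<epsilon>: "\<epsilon> \<in> {0<..C\<^sub>\<mu>}"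
        and sep: "\<forall>\<epsilon>\<in>{0<..<p}. separated \<mu> B \<and> separated \<mu> (approx_diff_set \<delta> \<epsilon> e C A)"
      for A B C \<epsilon>
    proof -
      have sepB: "separated \<mu> B" and sepCA: "separated \<mu> (approx_diff_set \<delta> \<epsilon> e C A)"
        using sep[rule_format, of \<epsilon>] \<epsilon> C\<^sub>\<mu> by auto
      show ?thesis
        unfolding approx_diff_set_def
      proof (rule ruzsa_injection_exists)
        fix a b c a' b' c'
        assume abc: "a \<in> A" "b \<in> B" "c \<in> C" "a' \<in> A" "b' \<in> B" "c' \<in> C"
          and "approx_diff \<delta> \<epsilon> e b c = approx_diff \<delta> \<epsilon> e b' c'"
            "approx_diff \<delta> \<epsilon> e b a = approx_diff \<delta> \<epsilon> e b' a'"
        then have "dist (approx_diff \<delta> \<epsilon> e c a) (approx_diff \<delta> \<epsilon> e c' a') < \<mu> \<and>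
            (c = c' \<longrightarrow> dist b b' < \<mu>)"
          using sub K \<epsilon> C\<^sub>\<mu> by (intro q[rule_format]) (auto simp del: mem_cball)
        moreover have "approx_diff \<delta> \<epsilon> e c a \<in> approx_diff_set \<delta> \<epsilon> e C A"
          "approx_diff \<delta> \<epsilon> e c' a' \<in> approx_diff_set \<delta> \<epsilon> e C A"
          using abc by (auto simp: approx_diff_set_def)
        \<comment> \<open>Separation at the given scale upgrades both bounds by \<open>\<mu>\<close>
          to equalities.\<close>
        ultimately show "approx_diff \<delta> \<epsilon> e c a = approx_diff \<delta> \<epsilon> e c' a' \<and> (c = c' \<longrightarrow> b = b')"
          using sepB sepCA abc unfolding separated_def by blast
      qed
    qed
    with C\<^sub>\<mu>(1,2) show "\<exists>C\<^sub>\<mu>. 0 < C\<^sub>\<mu> \<and> C\<^sub>\<mu> < p \<and>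
        (\<forall>A B C.
          finite A \<and> finite B \<and> finite C \<and> A \<subseteq> K \<and> B \<subseteq> K \<and> C \<subseteq> K \<and>
          (\<forall>\<epsilon>\<in>{0<..<p}. separated \<mu> B \<and> separated \<mu> (approx_diff_set \<delta> \<epsilon> e C A)) \<longrightarrow>
          (\<forall>\<epsilon>\<in>{0<..C\<^sub>\<mu>}. \<exists>i.
            i \<in> approx_diff_set \<delta> \<epsilon> e C A \<times> B \<rightarrow>
                  approx_diff_set \<delta> \<epsilon> e B C \<times> approx_diff_set \<delta> \<epsilon> e B A \<and>
            inj_on i (approx_diff_set \<delta> \<epsilon> e C A \<times> B)))"
      by (intro exI[of _ C\<^sub>\<mu>]) blast
  qed
qed

end
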